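(* Let $M \ge 1$ be an integer and let $\phi: \Delta^{M-1} \to \mathbb{R}^M$ be a continuous map. Then there exists an infinite sequence of Bézier simplices $b^{(i)}: \Delta^{M-1} \to \mathbb{R}^M$ ($i = 1, 2, \dots$) such that $$\lim_{i \to \infty} \sup_{t \in \Delta^{M-1}} |\phi(t) - b^{(i)}(t)| = 0.$$
   Context: $\mathbb{N}$ denotes the set of nonnegative integers. The standard simplex is $\Delta^{M-1} := \{(t_1,\dots,t_M) \in \mathbb{R}^M : t_m \ge 0 \text{ for all } m,\ \sum_{m=1}^M t_m = 1\}$. For $D \in \mathbb{N}$ put $\mathbb{N}_D^M := \{(d_1,\dots,d_M) \in \mathbb{N}^M : \sum_{m=1}^M d_m = D\}$. For $t \in \mathbb{R}^M$ and $d \in \mathbb{N}^M$ write $t^d := t_1^{d_1} t_2^{d_2} \cdots t_M^{d_M}$, and for $d \in \mathbb{N}_D^M$ write $\binom{D}{d} := \frac{D!}{d_1!\, d_2! \cdots d_M!}$. A Bézier simplex of degree $D$ in $\mathbb{R}^M$ is a map $b: \Delta^{M-1} \to \mathbb{R}^M$ of the form $$b(t) = \sum_{d \in \mathbb{N}_D^M} \binom{D}{d} t^d p_d,$$ determined by control points $p_d \in \mathbb{R}^M$ ($d \in \mathbb{N}_D^M$). A Bézier simplex is a Bézier simplex of some degree $D \in \mathbb{N}$; the members of a sequence of Bézier simplices may have different degrees. $|\cdot|$ is the Euclidean norm. *)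

theory Defs
  imports "HOL-Analysis.Analysis"
begin

text \<open>
  Vectors and multi-indices with M components are indexed by a finite type
  \<open>'m\<close> with \<open>M = CARD('m)\<close>; since types are nonempty, \<open>M \<ge> 1\<close>. A map defined on the
  simplex is represented by a total function of which only the values on the simplex matter.
\<close>

definition std_simplex :: "(real ^ 'm) set" where
  "std_simplex = {t. (\<forall>m. t $ m \<ge> 0) \<and> (\<Sum>m\<in>UNIV. t $ m) = 1}"

definition multi_indices :: "nat \<Rightarrow> (nat ^ 'm) set" where
  "multi_indices D = {d. (\<Sum>m\<in>UNIV. d $ m) = D}"

definition monomial :: "real ^ 'm \<Rightarrow> nat ^ 'm \<Rightarrow> real" where
  "monomial t d = (\<Prod>m\<in>UNIV. (t $ m) ^ (d $ m))"

definition multinomial :: "nat \<Rightarrow> nat ^ 'm \<Rightarrow> real" where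
  "multinomial D d = fact D / (\<Prod>m\<in>UNIV. fact (d $ m))"

definition bezier_map ::
    "nat \<Rightarrow> (nat ^ 'm \<Rightarrow> real ^ 'm) \<Rightarrow> real ^ 'm \<Rightarrow> real ^ 'm" where
  "bezier_map D p t =
     (\<Sum>d\<in>multi_indices D. (multinomial D d * monomial t d) *\<^sub>R p d)"

definition is_bezier_simplex :: "(real ^ 'm \<Rightarrow> real ^ 'm) \<Rightarrow> bool" where
  "is_bezier_simplex b \<longleftrightarrow> (\<exists>D p. \<forall>t\<in>std_simplex. b t = bezier_map D p t)"

lemma finite_multi_indices: "finite (multi_indices D :: (nat ^ 'm) set)"
proof (rule finite_subset)
  show "multi_indices D \<subseteq> vec_lambda ` (UNIV \<rightarrow>\<^sub>E {..D} :: ('m \<Rightarrow> nat) set)"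
  proof
    fix d :: "nat ^ 'm" assume "d \<in> multi_indices D"
    then have "(\<Sum>m\<in>UNIV. d $ m) = D" by (simp add: multi_indices_def)
    then have "\<And>m. d $ m \<le> D"
      using member_le_sum[of _ UNIV "\<lambda>m. d $ m"] by fastforce
    then have "vec_nth d \<in> UNIV \<rightarrow>\<^sub>E {..D}" by auto
    then show "d \<in> vec_lambda ` (UNIV \<rightarrow>\<^sub>E {..D})"
      by (metis image_eqI vec_nth_inverse)
  qed
  show "finite (vec_lambda ` (UNIV \<rightarrow>\<^sub>E {..D} :: ('m \<Rightarrow> nat) set))"
    by (intro finite_imageI finite_PiE) auto
qed

lemma compact_simplex: "compact (std_simplex :: (real ^ 'm) set)"
proof -
  have "closed (std_simplex :: (real ^ 'm) set)"
    unfolding std_simplex_def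
    by (intro closed_Collect_conj closed_Collect_all closed_Collect_le closed_Collect_eq
        continuous_intros)
  moreover have "norm t \<le> 1" if "t \<in> std_simplex" for t :: "real ^ 'm"
    using norm_le_l1_cart[of t] that by (simp add: std_simplex_def)
  then have "bounded (std_simplex :: (real ^ 'm) set)"
    by (auto simp: bounded_iff)
  ultimately show ?thesis by (simp add: compact_eq_bounded_closed)
qed

lemma simplex_nonempty: "(std_simplex :: (real ^ 'm) set) \<noteq> {}"
proof -
  have "axis undefined 1 \<in> (std_simplex :: (real ^ 'm) set)"
    by (auto simp: std_simplex_def axis_def if_distrib cong: if_cong)
  then show ?thesis by blast
qed

text \<open>
  The error set is nonempty and bounded above, so the real-valued supremum
  of the error is a genuine least upper bound.
\<close>

lemma bdd_above_bezier_error: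
  fixes \<phi> b :: "real ^ 'm \<Rightarrow> real ^ 'm"
  assumes "continuous_on std_simplex \<phi>" "is_bezier_simplex b"
  shows "bdd_above ((\<lambda>t. norm (\<phi> t - b t)) ` std_simplex)"
proof -
  obtain D p where *: "\<And>t. t \<in> std_simplex \<Longrightarrow> b t = bezier_map D p t"
    using assms(2) by (auto simp: is_bezier_simplex_def)
  have "continuous_on std_simplex (bezier_map D p)"
    unfolding bezier_map_def monomial_def by (intro continuous_intros)
  then have "continuous_on std_simplex b"
    using * by (simp cong: continuous_on_cong)
  then have "continuous_on std_simplex (\<lambda>t. norm (\<phi> t - b t))"
    using assms(1) by (intro continuous_intros)
  then show ?thesis
    by (intro bounded_imp_bdd_above compact_imp_bounded compact_continuous_image compact_simplex)
qed

end

theory Submission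
  imports Defs
begin

text \<open>
  By the Stone--Weierstrass theorem \<open>\<phi>\<close> is a uniform limit of polynomial maps on the compact simplex.
  Since the coordinates sum to 1 there, multiplying by powers of \<open>t\<^sub>1 + \<dots> + t\<^sub>M\<close> turns every
  polynomial into a homogeneous one without changing its values on the simplex, and all components
  can be brought to one common degree; dividing the coefficients by the multinomial coefficients
  yields control points.
\<close>

text \<open>Agreement is asked for on the simplex only, so \<open>f\<close> does not determine
  \<open>D\<close>: one function can satisfy this for many degrees, which is what makes raising the
  degree possible.\<close>

definition homogeneous_on_simplex :: "nat \<Rightarrow> (real ^ 'm \<Rightarrow> real) \<Rightarrow> bool" where
  "homogeneous_on_simplex D f \<longleftrightarrow>
     (\<exists>c. \<forall>t\<in>std_simplex. f t = (\<Sum>d\<in>multi_indices D. c d * monomial t d))"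

lemma multi_indices_0: "multi_indices 0 = {0}"
  by (auto simp: multi_indices_def vec_eq_iff)

lemma monomial_0 [simp]: "monomial t 0 = 1"
  by (simp add: monomial_def)

lemma monomial_add: "monomial t (d + e) = monomial t d * monomial t e"
  by (simp add: monomial_def power_add prod.distrib)

lemma monomial_axis: "monomial t (axis m 1) = t $ m"
proof -
  have "monomial t (axis m 1) = (\<Prod>k\<in>UNIV. if k = m then t $ k else 1)"
    unfolding monomial_def by (intro prod.cong) (auto simp: axis_def)
  then show ?thesis by simp
qed

lemma axis_in_multi_indices: "axis m D \<in> multi_indices D"
  by (simp add: multi_indices_def axis_def if_distrib cong: if_cong)

lemma add_in_multi_indices:
  "d \<in> multi_indices D \<Longrightarrow> e \<in> multi_indices E \<Longrightarrow> d + e \<in> multi_indices (D + E)"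
  by (simp add: multi_indices_def sum.distrib)

lemma homogeneous_const: "homogeneous_on_simplex 0 (\<lambda>t. a)"
  unfolding homogeneous_on_simplex_def by (intro exI[of _ "\<lambda>_. a"]) (simp add: multi_indices_0)

lemma homogeneous_nth:
  fixes m :: "'m::finite"
  shows "homogeneous_on_simplex 1 (\<lambda>t. t $ m)"
proof -
  have "t $ m = (\<Sum>d\<in>multi_indices 1. (if d = axis m 1 then 1 else 0) * monomial t d)"
    for t :: "real ^ 'm"
    by (simp add: if_distrib[of "\<lambda>x. x * _"] finite_multi_indices axis_in_multi_indices
        monomial_axis[unfolded One_nat_def] cong: if_cong)
  then show ?thesis
    unfolding homogeneous_on_simplex_def
    by (intro exI[of _ "\<lambda>d. if d = axis m 1 then 1 else 0"]) blast
qed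

lemma homogeneous_add:
  assumes "homogeneous_on_simplex D f" "homogeneous_on_simplex D g"
  shows "homogeneous_on_simplex D (\<lambda>t. f t + g t)"
proof -
  obtain a b where "\<And>t. t \<in> std_simplex \<Longrightarrow> f t = (\<Sum>d\<in>multi_indices D. a d * monomial t d)"
    and "\<And>t. t \<in> std_simplex \<Longrightarrow> g t = (\<Sum>d\<in>multi_indices D. b d * monomial t d)"
    using assms unfolding homogeneous_on_simplex_def by blast
  then show ?thesis
    unfolding homogeneous_on_simplex_def
    by (intro exI[of _ "\<lambda>d. a d + b d"]) (simp add: sum.distrib distrib_right)
qed

lemma homogeneous_mult:
  fixes f g :: "real ^ 'm \<Rightarrow> real"
  assumes "homogeneous_on_simplex D f" "homogeneous_on_simplex E g"
  shows "homogeneous_on_simplex (D + E) (\<lambda>t. f t * g t)"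
proof -
  obtain a b where f: "\<And>t. t \<in> std_simplex \<Longrightarrow> f t = (\<Sum>d\<in>multi_indices D. a d * monomial t d)"
    and g: "\<And>t. t \<in> std_simplex \<Longrightarrow> g t = (\<Sum>d\<in>multi_indices E. b d * monomial t d)"
    using assms unfolding homogeneous_on_simplex_def by blast
  let ?S = "multi_indices D \<times> multi_indices E :: ((nat ^ 'm) \<times> (nat ^ 'm)) set"
  \<comment> \<open>Convolution of the coefficients: every pair of exponents with sum
    \<open>k\<close> contributes to the monomial of \<open>k\<close>.\<close>
  define c where "c k = (\<Sum>(d, e) | (d, e) \<in> ?S \<and> d + e = k. a d * b e)" for k
  have "f t * g t = (\<Sum>k\<in>multi_indices (D + E). c k * monomial t k)"
    if t: "t \<in> std_simplex" for t
  proof -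
    have "f t * g t = (\<Sum>(d, e)\<in>?S. a d * b e * monomial t (d + e))"
      using f[OF t] g[OF t]
      by (simp add: sum_product sum.cartesian_product monomial_add mult_ac)
    \<comment> \<open>The sum over pairs is split along the fibres of addition, whose values on
      \<open>?S\<close> lie in \<open>multi_indices (D + E)\<close>.\<close>
    also have "\<dots> = (\<Sum>k\<in>multi_indices (D + E).
        \<Sum>x | x \<in> ?S \<and> (case x of (d, e) \<Rightarrow> d + e) = k.
          (case x of (d, e) \<Rightarrow> a d * b e * monomial t (d + e)))"
      by (intro sum.group[symmetric])
        (auto simp: finite_multi_indices add_in_multi_indices)
    also have "\<dots> = (\<Sum>k\<in>multi_indices (D + E). c k * monomial t k)"
      unfolding c_def sum_distrib_right by (intro sum.cong) auto
    finally show ?thesis .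
  qed
  then show ?thesis
    unfolding homogeneous_on_simplex_def by blast
qed

lemma homogeneous_cong:
  "(\<And>t. t \<in> std_simplex \<Longrightarrow> f t = g t) \<Longrightarrow>
     homogeneous_on_simplex D f \<longleftrightarrow> homogeneous_on_simplex D g"
  by (simp add: homogeneous_on_simplex_def)

lemma homogeneous_sum:
  assumes "finite A" "A \<noteq> {}" "\<And>i. i \<in> A \<Longrightarrow> homogeneous_on_simplex D (f i)"
  shows "homogeneous_on_simplex D (\<lambda>t. \<Sum>i\<in>A. f i t)"
  using assms by (induction A rule: finite_ne_induct) (simp_all add: homogeneous_add)

text \<open>On the simplex, 1 is the \<open>D\<close>-th power of the coordinate sum. Each induction
  step multiplies by one more copy of that sum, a form of degree 1.\<close>

lemma homogeneous_one: "homogeneous_on_simplex D (\<lambda>t :: real ^ 'm. 1)"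
proof (induction D)
  case 0
  show ?case by (rule homogeneous_const)
next
  case (Suc D)
  have "homogeneous_on_simplex 1 (\<lambda>t :: real ^ 'm. \<Sum>m\<in>UNIV. t $ m)"
    by (intro homogeneous_sum homogeneous_nth) auto
  then have "homogeneous_on_simplex (D + 1) (\<lambda>t :: real ^ 'm. 1 * (\<Sum>m\<in>UNIV. t $ m))"
    by (rule homogeneous_mult[OF Suc])
  then show ?case
    by (subst homogeneous_cong[of _ "\<lambda>t. 1 * (\<Sum>m\<in>UNIV. t $ m)"]) (auto simp: std_simplex_def)
qed

text \<open>Multiply by the constant 1, read as a form of degree \<open>E - D\<close>.\<close>

lemma homogeneous_elevate:
  assumes "homogeneous_on_simplex D f" "D \<le> E"
  shows "homogeneous_on_simplex E f"
  using homogeneous_mult[OF assms(1) homogeneous_one[of "E - D"]] assms(2) by simp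

text \<open>The linear generators of \<open>real_polynomial_function\<close> are arbitrary bounded
  linear functionals; expansion in the standard basis reduces them to the coordinates.\<close>

lemma bounded_linear_eq_sum_nth:
  fixes f :: "real ^ 'm \<Rightarrow> real"
  assumes "bounded_linear f"
  shows "f t = (\<Sum>m\<in>UNIV. f (axis m 1) * t $ m)"
proof -
  have "f t = f (\<Sum>m\<in>UNIV. t $ m *\<^sub>R axis m 1)"
    by (simp add: basis_expansion flip: scalar_mult_eq_scaleR)
  then show ?thesis
    using bounded_linear.linear[OF assms] by (simp add: linear_sum linear_cmul mult.commute)
qed

lemma real_polynomial_function_homogeneous:
  "real_polynomial_function f \<Longrightarrow> \<exists>D. homogeneous_on_simplex D f"
proof (induction rule: real_polynomial_function.induct)
  case (linear f)
  have "homogeneous_on_simplex (0 + 1) (\<lambda>t. \<Sum>m\<in>UNIV. f (axis m 1) * t $ m)"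
    by (intro homogeneous_sum homogeneous_mult homogeneous_const homogeneous_nth) auto
  then show ?case
    using bounded_linear_eq_sum_nth[OF linear] by (metis (no_types, lifting) homogeneous_cong)
next
  case (const c)
  show ?case using homogeneous_const by blast
next
  case (add f g)
  then obtain D E where "homogeneous_on_simplex D f" "homogeneous_on_simplex E g"
    by blast
  \<comment> \<open>Coefficients can be added only within one degree, so both summands are first
    raised to the larger one.\<close>
  then have "homogeneous_on_simplex (max D E) (\<lambda>t. f t + g t)"
    by (intro homogeneous_add) (auto elim: homogeneous_elevate)
  then show ?case ..
next
  case (mult f g)
  then show ?case by (blast dest: homogeneous_mult)
qed

lemma multinomial_nonzero: "multinomial D d \<noteq> 0"
  by (simp add: multinomial_def)

lemma is_bezier_simplex_polynomial_function:
  fixes g :: "real ^ 'm \<Rightarrow> real ^ 'm"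
  assumes "polynomial_function g"
  shows "is_bezier_simplex g"
proof -
  have "\<exists>D. homogeneous_on_simplex D (\<lambda>t. g t $ m)" for m
    using assms real_polynomial_function_homogeneous bounded_linear_vec_nth
    unfolding polynomial_function_def o_def by blast
  then obtain D where "\<And>m. homogeneous_on_simplex (D m) (\<lambda>t. g t $ m)"
    by metis
  \<comment> \<open>A Bezier simplex has a single degree for all components. As the index type is
    finite, the componentwise degrees have a maximum, and every component is raised to it.\<close>
  then have "homogeneous_on_simplex (Max (range D)) (\<lambda>t. g t $ m)" for m
    by (rule homogeneous_elevate) simp
  then obtain c where c: "\<And>m t. t \<in> std_simplex \<Longrightarrow>
      g t $ m = (\<Sum>d\<in>multi_indices (Max (range D)). c m d * monomial t d)"
    unfolding homogeneous_on_simplex_def by metis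
  \<comment> \<open>The division cancels the nonzero factor \<open>multinomial\<close> in
    \<open>bezier_map\<close>; coordinate \<open>m\<close> of a control point comes from component
    \<open>m\<close> of \<open>g\<close>.\<close>
  define p where "p d = (\<chi> m. c m d / multinomial (Max (range D)) d)" for d
  have "g t = bezier_map (Max (range D)) p t" if "t \<in> std_simplex" for t
    by (simp add: vec_eq_iff c[OF that] bezier_map_def p_def multinomial_nonzero mult.commute)
  then show ?thesis
    unfolding is_bezier_simplex_def by blast
qed

theorem theorem1:
  fixes \<phi> :: "real ^ 'm \<Rightarrow> real ^ 'm"
  assumes "continuous_on std_simplex \<phi>"
  shows "\<exists>b :: nat \<Rightarrow> real ^ 'm \<Rightarrow> real ^ 'm.
           (\<forall>i. is_bezier_simplex (b i)) \<and>
           (\<lambda>i. SUP t\<in>std_simplex. norm (\<phi> t - b i t)) \<longlonglongrightarrow> 0"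
proof -
  \<comment> \<open>Indices start at 0, so the tolerance is 1/(i+1), which is always
    positive.\<close>
  have "\<exists>g. polynomial_function g \<and> (\<forall>t\<in>std_simplex. norm (\<phi> t - g t) < inverse (real (Suc i)))"
    for i
    by (rule Stone_Weierstrass_polynomial_function[OF compact_simplex assms]) simp
  then obtain b where b: "\<And>i. polynomial_function (b i)"
    and close: "\<And>i t. t \<in> std_simplex \<Longrightarrow> norm (\<phi> t - b i t) < inverse (real (Suc i))"
    by metis
  have bezier: "is_bezier_simplex (b i)" for i
    by (rule is_bezier_simplex_polynomial_function[OF b])
  \<comment> \<open>The strict pointwise bound survives only as a weak one in the supremum, which
    suffices for the squeeze.\<close>
  have upper: "(SUP t\<in>std_simplex. norm (\<phi> t - b i t)) \<le> inverse (real (Suc i))" for i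
    using close by (intro cSUP_least simplex_nonempty) (simp add: less_imp_le)
  \<comment> \<open>Nonnegativity of a real supremum is not automatic: it is read off at one point
    of the simplex, using that the errors are bounded above.\<close>
  have lower: "0 \<le> (SUP t\<in>std_simplex. norm (\<phi> t - b i t))" for i
  proof -
    obtain t where t: "t \<in> (std_simplex :: (real ^ 'm) set)"
      using simplex_nonempty by blast
    have "0 \<le> norm (\<phi> t - b i t)"
      by simp
    also have "\<dots> \<le> (SUP t\<in>std_simplex. norm (\<phi> t - b i t))"
      by (rule cSUP_upper[OF t bdd_above_bezier_error[OF assms bezier]])
    finally show ?thesis .
  qed
  have "(\<lambda>i. SUP t\<in>std_simplex. norm (\<phi> t - b i t)) \<longlonglongrightarrow> 0"
    by (rule tendsto_sandwich[OF _ _ tendsto_const LIMSEQ_inverse_real_of_nat])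
      (intro always_eventually allI lower upper)+
  with bezier show ?thesis by blast
qed

end
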